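(* Let $R$ be a ring with involution, let $a\in R$ be Drazin invertible, let $b\in R$, $f=a+b$, and let $s$ be a positive integer. If $1+a^Db$ is invertible, then the following statements are equivalent: (1) $(1-aa^D)baa^D=0$ and $(a+b)^s(1-aa^D)=0$; (2) $aa^Db(1-aa^D)=0$ and $(1-aa^D)(a+b)^s=0$; (3) $aa^Db=baa^D$ and $(1-aa^D)(a+b)^s=0$; (4) $f$ is Drazin invertible and $f^D=(1+a^Db)^{-1}a^D$ with ${\rm i}(f)\leqslant s$. In this case, $T_l(f)=\alpha T_l(a)$ and $T_r(f)=T_r(a)\beta$, where $\alpha=(1+a^Db)^{-1}$ and $\beta=(1+ba^D)^{-1}$.
   Context: Rings are associative with identity $1$. An element $a\in R$ is Drazin invertible if there are $x\in R$ and a positive integer $k$ with $xa^{k+1}=a^k$, $ax^2=x$, $xa=ax$; then $x$ is unique and denoted $a^D$, and the smallest positive integer $k$ for which these equations hold is the Drazin index ${\rm i}(a)$. For a Drazin invertible $a$: $T_l(a)=\{x\in R:\ xa^{k+1}=a^k \text{ for some positive integer } k,\ ax^2=x\}$ (equivalently, $k$ may be taken equal to ${\rm i}(a)$), and $T_r(a)=\{z\in R:\ a^{{\rm i}(a)+1}z=a^{{\rm i}(a)},\ z^2a=z\}$. By Jacobson's lemma, $1+ba^D$ is invertible whenever $1+a^Db$ is. For $c\in R$ and $X\subseteq R$, $cX=\{cx:x\in X\}$ and $Xc=\{xc:x\in X\}$. *)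

theory Defs
  imports Main
begin

text \<open>
  Associative rings with identity are rendered by the sort \<open>{ring, monoid_mult}\<close>. In contrast to
  \<open>ring_1\<close> it does not demand \<open>0 \<noteq> 1\<close>, so the zero ring is not excluded.
\<close>

definition ring_involution :: "('a::{ring, monoid_mult} \<Rightarrow> 'a) \<Rightarrow> bool" where
  "ring_involution star \<longleftrightarrow>
     (\<forall>x. star (star x) = x) \<and>
     (\<forall>x y. star (x + y) = star x + star y) \<and>
     (\<forall>x y. star (x * y) = star y * star x)"

definition is_ring_inverse :: "'a::{ring, monoid_mult} \<Rightarrow> 'a \<Rightarrow> bool" where
  "is_ring_inverse a x \<longleftrightarrow> a * x = 1 \<and> x * a = 1"

definition ring_invertible :: "'a::{ring, monoid_mult} \<Rightarrow> bool" where
  "ring_invertible a \<longleftrightarrow> (\<exists>x. is_ring_inverse a x)"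

definition ring_inverse :: "'a::{ring, monoid_mult} \<Rightarrow> 'a" where
  "ring_inverse a = (THE x. is_ring_inverse a x)"

lemma is_ring_inverse_unique:
  assumes "is_ring_inverse a x" "is_ring_inverse a y"
  shows "x = y"
proof -
  have "x = x * (a * y)" using assms by (simp add: is_ring_inverse_def)
  also have "\<dots> = (x * a) * y" by (simp only: mult.assoc)
  also have "\<dots> = y" using assms by (simp add: is_ring_inverse_def)
  finally show ?thesis .
qed

lemma ring_inverse_eqI: "is_ring_inverse a x \<Longrightarrow> ring_inverse a = x"
  unfolding ring_inverse_def by (blast intro: the_equality is_ring_inverse_unique)

text \<open>Jacobson's lemma\<close>

lemma ring_invertible_one_plus_swap:
  fixes b c :: "'a::{ring, monoid_mult}"
  assumes "ring_invertible (1 + c * b)"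
  shows "ring_invertible (1 + b * c)"
proof -
  obtain u where u: "(1 + c * b) * u = 1" "u * (1 + c * b) = 1"
    using assms by (auto simp: ring_invertible_def is_ring_inverse_def)
  have "(1 + b * c) * (1 - b * u * c) = 1 + b * c - b * ((1 + c * b) * u) * c"
    by (simp add: algebra_simps)
  moreover have "(1 - b * u * c) * (1 + b * c) = 1 + b * c - b * (u * (1 + c * b)) * c"
    by (simp add: algebra_simps)
  ultimately have "is_ring_inverse (1 + b * c) (1 - b * u * c)"
    by (simp add: u is_ring_inverse_def)
  then show ?thesis by (auto simp: ring_invertible_def)
qed

definition drazin_eqs :: "'a::{ring, monoid_mult} \<Rightarrow> 'a \<Rightarrow> nat \<Rightarrow> bool" where
  "drazin_eqs a x k \<longleftrightarrow> x * a ^ (k + 1) = a ^ k \<and> a * x ^ 2 = x \<and> x * a = a * x"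

definition is_drazin_inverse :: "'a::{ring, monoid_mult} \<Rightarrow> 'a \<Rightarrow> bool" where
  "is_drazin_inverse a x \<longleftrightarrow> (\<exists>k>0. drazin_eqs a x k)"

definition drazin_invertible :: "'a::{ring, monoid_mult} \<Rightarrow> bool" where
  "drazin_invertible a \<longleftrightarrow> (\<exists>x. is_drazin_inverse a x)"

definition drazin_inverse :: "'a::{ring, monoid_mult} \<Rightarrow> 'a" where
  "drazin_inverse a = (THE x. is_drazin_inverse a x)"

text \<open>The index ranges over positive integers; in particular invertible elements have index 1.\<close>

definition drazin_index :: "'a::{ring, monoid_mult} \<Rightarrow> nat" where
  "drazin_index a = (LEAST k. 0 < k \<and> drazin_eqs a (drazin_inverse a) k)"

lemma is_drazin_inverse_unique:
  fixes a x y :: "'a::{ring, monoid_mult}"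
  assumes "is_drazin_inverse a x" "is_drazin_inverse a y"
  shows "x = y"
proof -
  obtain k m where k: "drazin_eqs a x k" and m: "drazin_eqs a y m"
    using assms by (auto simp: is_drazin_inverse_def)
  define n where "n = k + m"
  have comm: "z * a ^ j = a ^ j * z" if "drazin_eqs a z i" for z i j
    using that by (induction j) (simp, metis drazin_eqs_def mult.assoc power_Suc)
  have proj: "(a * z) * a ^ n = a ^ n" if z: "drazin_eqs a z i" and "i \<le> n" for z i
  proof -
    obtain l where l: "n = i + l" using \<open>i \<le> n\<close> le_Suc_ex by blast
    have c: "a * z = z * a" and i: "z * a ^ (i + 1) = a ^ i"
      using z by (simp_all add: drazin_eqs_def)
    have "(a * z) * a ^ n = (z * a ^ (i + 1)) * a ^ l"
      by (simp add: c l power_add mult.assoc)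
    then show ?thesis unfolding i by (simp add: l power_add)
  qed
  have fact: "\<exists>w. a * z = w * a ^ n \<and> a * z = a ^ n * w" if z: "drazin_eqs a z i" for z i
  proof -
    have c: "a * z = z * a" and i: "a * (z * z) = z"
      using z by (simp_all add: drazin_eqs_def power2_eq_square)
    have "z = a ^ j * z ^ Suc j" for j
    proof (induction j)
      case (Suc j)
      have "a ^ Suc j * z ^ Suc (Suc j) = a ^ j * (a * (z * z)) * z ^ j"
        by (simp only: power_Suc2[of a] power_Suc[of z] mult.assoc)
      also have "\<dots> = z"
        using Suc.IH by (simp add: i mult.assoc)
      finally show ?case by simp
    qed simp
    then have n: "z = a ^ n * z ^ Suc n" .
    have "z ^ j * a ^ n = a ^ n * z ^ j" for j
      by (induction j) (simp, simp add: mult.assoc, simp flip: mult.assoc add: comm[OF z])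
    then have n': "z ^ Suc n * a ^ n = z" by (simp only: n[symmetric])
    have "a * z = z ^ Suc n * a * a ^ n"
      by (metis c n' mult.assoc power_commutes)
    moreover have "a * z = a ^ n * (z ^ Suc n * a)"
      by (metis c n mult.assoc)
    ultimately show ?thesis by blast
  qed
  obtain u where u: "a * x = a ^ n * u" using fact[OF k] by blast
  obtain v where v: "a * y = v * a ^ n" using fact[OF m] by blast
  have "(a * y) * (a * x) = a * x"
    using proj[OF m] u by (simp add: n_def flip: mult.assoc)
  moreover have "(a * y) * (a * x) = a * y"
  proof -
    have "a ^ n * (a * x) = a * (a ^ n * x)"
      by (simp add: power_commutes flip: mult.assoc)
    also have "\<dots> = (a * x) * a ^ n" by (simp add: comm[OF k] mult.assoc)
    also have "\<dots> = a ^ n" using proj[OF k] by (simp add: n_def)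
    finally show ?thesis using v by (simp add: mult.assoc)
  qed
  ultimately have e: "a * x = a * y" by simp
  have x: "x = (a * x) * x" and y: "y = (a * y) * y"
    and ya: "y * a = a * y"
    using k m by (simp_all add: drazin_eqs_def power2_eq_square mult.assoc)
  have "x = (y * a) * x" using x e ya by simp
  also have "\<dots> = y * (a * y)" by (simp only: mult.assoc e)
  also have "\<dots> = (y * a) * y" by (simp only: mult.assoc)
  also have "\<dots> = y" using y ya by simp
  finally show ?thesis .
qed

lemma drazin_inverse_eqI: "is_drazin_inverse a x \<Longrightarrow> drazin_inverse a = x"
  unfolding drazin_inverse_def by (blast intro: the_equality is_drazin_inverse_unique)

text \<open>The following sets are only meant for Drazin invertible \<open>a\<close>.\<close>

definition T_l :: "'a::{ring, monoid_mult} \<Rightarrow> 'a set" where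
  "T_l a = {x. (\<exists>k>0. x * a ^ (k + 1) = a ^ k) \<and> a * x ^ 2 = x}"

definition T_r :: "'a::{ring, monoid_mult} \<Rightarrow> 'a set" where
  "T_r a = {z. a ^ (drazin_index a + 1) * z = a ^ drazin_index a \<and> z ^ 2 * a = z}"

end

theory Submission
  imports Defs
begin

text \<open>
  Put \<open>p = a a\<^sup>D\<close> and \<open>y = \<alpha> a\<^sup>D\<close>, where \<open>\<alpha>\<close> and \<open>\<beta>\<close> are the inverses of \<open>1 + a\<^sup>D b\<close> and
  \<open>1 + b a\<^sup>D\<close>. From \<open>(1 + a\<^sup>D b) a\<^sup>D = a\<^sup>D (1 + b a\<^sup>D)\<close> one gets \<open>y = a\<^sup>D \<beta>\<close>, hence \<open>p y = y = y p\<close>,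
  and expanding \<open>f = a + b\<close> gives
  \<open>y f = 1 - \<alpha> (1 - p)\<close> and \<open>f y = 1 - (1 - p) \<beta>\<close>, so that \<open>y f p = p = p f y\<close>.
  Everything rests on these identities: \<open>f\<close> can be cancelled from the left in front of \<open>p\<close> and from
  the right behind \<open>p\<close>, before any of the four conditions is assumed.

  Since \<open>a\<close> commutes with \<open>p\<close>, the conditions on \<open>b\<close> in (1), (2), (3) say that, in the Peirce
  decomposition for \<open>p\<close>, the element \<open>f\<close> is upper triangular, lower triangular, or diagonal.
  A triangular \<open>f\<close> that can be cancelled next to \<open>p\<close> and whose power \<open>f\<^sup>s\<close> is annihilated by
  \<open>1 - p\<close> on the appropriate side is already diagonal, because \<open>f\<close> commutes with \<open>f\<^sup>s\<close>
  (\<open>triangular_imp_commute\<close>, \<open>triangular_imp_commute'\<close>). This makes (1), (2) and (3) equivalent.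
  If \<open>f\<close> is diagonal, then \<open>y f = p = f y\<close>, so \<open>p f\<^sup>s = f\<^sup>s\<close> says that \<open>y\<close> is the Drazin inverse of
  \<open>f\<close>, with index at most \<open>s\<close>. Conversely, if \<open>y = f\<^sup>D\<close>, then \<open>y f = f y\<close> is unchanged by right
  multiplication with \<open>p\<close>; together with \<open>y f p = p\<close> this forces \<open>y f = p\<close>, and the index bound
  gives \<open>p f\<^sup>s = f\<^sup>s\<close>.

  The sets \<open>T\<^sub>l\<close> and \<open>T\<^sub>r\<close> of an element depend only on its Drazin inverse and on the corresponding
  idempotent (\<open>T_l_eq\<close>, \<open>T_r_eq\<close>). Under the four conditions \<open>f\<close> and \<open>a\<close> have the same idempotent
  \<open>p\<close>, which commutes with \<open>\<alpha>\<close> and \<open>\<beta>\<close>, and \<open>f\<^sup>D = \<alpha> a\<^sup>D = a\<^sup>D \<beta>\<close>; so multiplication by these units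
  carries the sets of \<open>a\<close> onto those of \<open>f\<close>.
\<close>

section \<open>Drazin inverses and their one-sided companions\<close>

lemma is_drazin_inverse_drazin_inverse:
  "drazin_invertible a \<Longrightarrow> is_drazin_inverse a (drazin_inverse a)"
  using drazin_inverse_eqI by (auto simp: drazin_invertible_def)

lemma drazin_eqs_drazin_index:
  assumes "is_drazin_inverse a x"
  shows "drazin_eqs a x (drazin_index a)"
  using assms drazin_inverse_eqI[OF assms]
    LeastI_ex[of "\<lambda>k. 0 < k \<and> drazin_eqs a (drazin_inverse a) k"]
  unfolding drazin_index_def is_drazin_inverse_def by auto

lemma drazin_index_le:
  assumes "drazin_eqs a x k" "0 < k"
  shows "drazin_index a \<le> k"
proof -
  have "drazin_inverse a = x"
    using assms by (intro drazin_inverse_eqI) (auto simp: is_drazin_inverse_def)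
  then show ?thesis
    unfolding drazin_index_def using assms by (intro Least_le) simp
qed

lemma drazin_eqs_proj:
  assumes "drazin_eqs a x k"
  shows "a * x * x = x" "x * (a * x) = x" "a * x * (a * x) = a * x" "a * x * a = a * (a * x)"
    "x * a = a * x"
    "a * x ^ 2 = x" "x ^ 2 * a = x"
  using assms unfolding drazin_eqs_def power2_eq_square by (metis mult.assoc)+

lemma drazin_eqs_proj_power:
  assumes "drazin_eqs a x k" "k \<le> n"
  shows "a * x * a ^ n = a ^ n" "a ^ n * (a * x) = a ^ n"
proof -
  obtain l where n: "n = k + l" using assms(2) le_Suc_ex by blast
  have k: "x * (a * a ^ k) = a ^ k" and xa: "x * a = a * x"
    using assms by (auto simp: drazin_eqs_def)
  have "a * x * a ^ n = (x * (a * a ^ k)) * a ^ l"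
    by (simp add: n power_add xa flip: mult.assoc)
  then show 1: "a * x * a ^ n = a ^ n" by (simp add: n k power_add)
  have "a * x * a ^ j = a ^ j * (a * x)" for j
    by (induction j) (simp, metis mult.assoc power_Suc xa)
  with 1 show "a ^ n * (a * x) = a ^ n" by simp
qed

text \<open>
  Iterating \<open>z = a z\<^sup>2\<close> shows that \<open>z\<close> lies in every right ideal \<open>a\<^sup>n R\<close>. This is how an element of
  \<open>T_l a\<close> is seen to be fixed by left multiplication with \<open>a a\<^sup>D\<close>, which fixes high powers of \<open>a\<close>.
\<close>

lemma power_mult_power_Suc_left:
  fixes a z :: "'a::monoid_mult"
  assumes "a * z ^ 2 = z"
  shows "a ^ n * z ^ Suc n = z"
proof (induction n)
  case (Suc n)
  have "a ^ Suc n * z ^ Suc (Suc n) = a ^ n * (a * z ^ 2) * z ^ n"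
    by (simp only: power_Suc2[of a] power_Suc[of z] mult.assoc power2_eq_square)
  also have "\<dots> = a ^ n * z ^ Suc n"
    by (simp only: assms mult.assoc power_Suc)
  finally show ?case using Suc.IH by simp
qed simp

lemma power_Suc_mult_power_right:
  fixes a z :: "'a::monoid_mult"
  assumes "z ^ 2 * a = z"
  shows "z ^ Suc n * a ^ n = z"
proof (induction n)
  case (Suc n)
  have "z ^ Suc (Suc n) * a ^ Suc n = z ^ n * (z ^ 2 * a) * a ^ n"
    by (simp only: power_Suc[of a] power_Suc2[of z] mult.assoc power2_eq_square)
  also have "\<dots> = z ^ Suc n * a ^ n"
    by (simp only: assms mult.assoc power_Suc2)
  finally show ?case using Suc.IH by simp
qed simp

text \<open>
  For \<open>z \<in> T_l a\<close>, the equation \<open>z a\<^bsup>m + 1\<^esup> = a\<^sup>m\<close> multiplied on the right by the \<open>m + 1\<close>-st power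
  of \<open>x = a\<^sup>D\<close> becomes \<open>z (a x) = x\<close>. The resulting description is free of powers of \<open>a\<close>,
  which makes \<open>T_l\<close> of different elements with the same idempotent comparable.
\<close>

lemma T_l_eq:
  fixes a x :: "'a::{ring, monoid_mult}"
  assumes "is_drazin_inverse a x"
  shows "T_l a = {z. a * x * z = z \<and> z * (a * x) = x}"
proof (intro set_eqI iffI)
  obtain k where k: "0 < k" "drazin_eqs a x k"
    using assms by (auto simp: is_drazin_inverse_def)
  note p = drazin_eqs_proj[OF k(2)]
  fix z
  show "z \<in> {z. a * x * z = z \<and> z * (a * x) = x}" if z: "z \<in> T_l a"
  proof -
    obtain m where m: "z * a ^ (m + 1) = a ^ m" and z2: "a * z ^ 2 = z"
      using z by (auto simp: T_l_def)
    have "a * x * z = (a * x * a ^ k) * z ^ Suc k"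
      using power_mult_power_Suc_left[OF z2, of k] by (simp only: mult.assoc)
    also have "\<dots> = z"
      by (simp only: drazin_eqs_proj_power[OF k(2)] power_mult_power_Suc_left[OF z2])
    finally have "a * x * z = z" .
    moreover have "z * (a * x) = (z * a ^ (m + 1)) * x ^ Suc m"
    proof -
      have "a ^ (m + 1) * x ^ Suc m = a * (a ^ m * x ^ Suc m)"
        by (simp add: mult.assoc)
      also have "\<dots> = a * x" by (simp only: power_mult_power_Suc_left[OF p(6)])
      finally show ?thesis by (simp only: mult.assoc)
    qed
    ultimately show ?thesis
      by (simp only: m power_mult_power_Suc_left[OF p(6)] mem_Collect_eq simp_thms)
  qed
  show "z \<in> T_l a" if "z \<in> {z. a * x * z = z \<and> z * (a * x) = x}"
  proof -
    have z: "a * x * z = z" "z * (a * x) = x" using that by auto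
    have "z * z = x * z" using z by (metis mult.assoc)
    then have "a * z ^ 2 = z" by (simp add: power2_eq_square z flip: mult.assoc)
    moreover have "z * a ^ (k + 1) = z * (a * x) * a ^ (k + 1)"
      using drazin_eqs_proj_power(1)[OF k(2), of "k + 1"] by (simp add: mult.assoc)
    then have "z * a ^ (k + 1) = a ^ k" using k(2) by (simp add: z drazin_eqs_def)
    ultimately show ?thesis using k(1) by (auto simp: T_l_def)
  qed
qed

lemma T_r_eq:
  fixes a x :: "'a::{ring, monoid_mult}"
  assumes "is_drazin_inverse a x"
  shows "T_r a = {z. z * (a * x) = z \<and> a * x * z = x}"
proof (intro set_eqI iffI)
  define k where "k = drazin_index a"
  have k: "drazin_eqs a x k"
    unfolding k_def by (rule drazin_eqs_drazin_index[OF assms])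
  note p = drazin_eqs_proj[OF k]
  fix z
  show "z \<in> {z. z * (a * x) = z \<and> a * x * z = x}" if z: "z \<in> T_r a"
  proof -
    have m: "a ^ (k + 1) * z = a ^ k" and z2: "z ^ 2 * a = z"
      using z by (auto simp: T_r_def k_def)
    have "z * (a * x) = z ^ Suc k * (a ^ k * (a * x))"
      using power_Suc_mult_power_right[OF z2, of k] by (simp only: flip: mult.assoc)
    also have "\<dots> = z"
      by (simp only: drazin_eqs_proj_power[OF k] power_Suc_mult_power_right[OF z2])
    finally have "z * (a * x) = z" .
    moreover have "a * x * z = x ^ Suc k * (a ^ (k + 1) * z)"
    proof -
      have "x ^ Suc k * a ^ (k + 1) = (x ^ Suc k * a ^ k) * a"
        by (simp add: mult.assoc power_commutes)
      also have "\<dots> = a * x" by (simp only: power_Suc_mult_power_right[OF p(7)] p(5))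
      finally show ?thesis by (simp only: flip: mult.assoc)
    qed
    ultimately show ?thesis
      by (simp only: m power_Suc_mult_power_right[OF p(7)] mem_Collect_eq simp_thms)
  qed
  show "z \<in> T_r a" if "z \<in> {z. z * (a * x) = z \<and> a * x * z = x}"
  proof -
    have z: "z * (a * x) = z" "a * x * z = x" using that by auto
    have "z * z = z * x" using z by (metis mult.assoc)
    then have "z ^ 2 * a = z" by (simp add: power2_eq_square z p(5) mult.assoc)
    moreover have "a ^ (k + 1) * z = a ^ (k + 1) * (a * x * z)"
      using drazin_eqs_proj_power(2)[OF k, of "k + 1"] by (simp flip: mult.assoc)
    then have "a ^ (k + 1) * z = a ^ (k + 1) * x"
      by (simp only: z)
    then have "a ^ (k + 1) * z = a ^ k * (a * x)"
      by (simp only: Suc_eq_plus1[symmetric] power_Suc2 mult.assoc)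
    then have "a ^ (k + 1) * z = a ^ k"
      by (simp only: drazin_eqs_proj_power(2)[OF k order_refl])
    ultimately show ?thesis by (auto simp: T_r_def k_def)
  qed
qed

section \<open>Triangular elements with a nilpotent block\<close>

text \<open>
  The hypothesis \<open>f p = p f p\<close> lets \<open>v f p = p\<close> be iterated to \<open>v\<^sup>s f\<^sup>s p = p\<close>. As \<open>f\<close> commutes with
  \<open>f\<^sup>s = f\<^sup>s p\<close>, both \<open>f\<^sup>s p f\<close> and \<open>f\<^sup>s p f p\<close> are equal to \<open>f\<^bsup>s + 1\<^esup>\<close>, and cancelling \<open>f\<^sup>s\<close> in front
  of \<open>p\<close> leaves \<open>p f = p f p\<close>: the other off-diagonal block of \<open>f\<close> vanishes as well.
\<close>

lemma triangular_imp_commute: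
  fixes f p v :: "'a::monoid_mult"
  assumes pp: "p * p = p" and fp: "f * p = p * f * p"
    and v: "v * f * p = p" and s: "f ^ s * p = f ^ s"
  shows "p * f = f * p"
proof -
  have pow: "f ^ n * p = p * f ^ n * p" for n
  proof (induction n)
    case (Suc n)
    have "f ^ Suc n * p = f * p * (f ^ n * p)" by (metis Suc.IH mult.assoc power_Suc)
    also have "\<dots> = p * (f * p * (f ^ n * p))" by (metis fp mult.assoc)
    also have "\<dots> = p * f ^ Suc n * p" by (metis Suc.IH mult.assoc power_Suc)
    finally show ?case .
  qed (simp add: pp)
  have cancel: "v ^ n * (f ^ n * p) = p" for n
  proof (induction n)
    case (Suc n)
    have "v ^ Suc n * (f ^ Suc n * p) = v ^ n * (v * (f * (f ^ n * p)))"
      by (simp only: power_Suc[of f] power_Suc2[of v] mult.assoc)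
    also have "v * (f * (f ^ n * p)) = v * f * p * (f ^ n * p)" by (metis pow mult.assoc)
    also have "\<dots> = f ^ n * p" by (metis v pow mult.assoc)
    finally show ?case using Suc.IH by simp
  qed simp
  have "f ^ s * p * f = f ^ s * p * (f * p)"
    by (metis s mult.assoc power_commutes)
  then have "v ^ s * (f ^ s * p) * f = v ^ s * (f ^ s * p) * (f * p)"
    by (metis mult.assoc)
  then show ?thesis by (metis cancel fp mult.assoc)
qed

text \<open>The same argument in the opposite ring.\<close>

lemma triangular_imp_commute':
  fixes f p w :: "'a::monoid_mult"
  assumes pp: "p * p = p" and pf: "p * f = p * f * p"
    and w: "p * f * w = p" and s: "p * f ^ s = f ^ s"
  shows "p * f = f * p"
proof -
  have pow: "p * f ^ n = p * f ^ n * p" for n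
  proof (induction n)
    case (Suc n)
    have "p * f ^ Suc n = (p * f ^ n) * (p * f)" by (metis Suc.IH mult.assoc power_Suc2)
    also have "\<dots> = (p * f ^ n) * (p * f) * p" by (metis pf mult.assoc)
    also have "\<dots> = p * f ^ Suc n * p" by (metis Suc.IH mult.assoc power_Suc2)
    finally show ?case .
  qed (simp add: pp)
  have cancel: "(p * f ^ n) * w ^ n = p" for n
  proof (induction n)
    case (Suc n)
    have "(p * f ^ Suc n) * w ^ Suc n = (p * f ^ n * f * w) * w ^ n"
      by (simp only: power_Suc2[of f] power_Suc[of w] mult.assoc)
    also have "p * f ^ n * f * w = p * f ^ n * (p * f * w)" by (metis pow mult.assoc)
    also have "\<dots> = p * f ^ n" by (metis w pow mult.assoc)
    finally show ?case using Suc.IH by simp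
  qed simp
  have "f * (p * f ^ s) = p * f * (p * f ^ s)"
    by (metis s mult.assoc power_commutes)
  then have "f * (p * f ^ s * w ^ s) = p * f * (p * f ^ s * w ^ s)"
    by (metis mult.assoc)
  then show ?thesis by (metis cancel pf mult.assoc)
qed

section \<open>The perturbed element\<close>

lemma is_ring_inverse_ring_inverse:
  "ring_invertible a \<Longrightarrow> is_ring_inverse a (ring_inverse a)"
  using ring_inverse_eqI by (auto simp: ring_invertible_def)

lemma is_ring_inverse_commute:
  assumes "is_ring_inverse u v" "p * u = u * p"
  shows "p * v = v * p"
proof -
  have "p * v = v * (u * p) * v"
    using assms by (simp add: is_ring_inverse_def flip: mult.assoc)
  also have "\<dots> = v * p * (u * v)" by (simp only: assms(2) [symmetric] mult.assoc)
  finally show ?thesis using assms(1) by (simp add: is_ring_inverse_def)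
qed

theorem theorem3p6:
  fixes star :: "'a::{ring, monoid_mult} \<Rightarrow> 'a"
    and a b f aD \<alpha> \<beta> :: 'a
    and s :: nat
  assumes "ring_involution star"
    and "drazin_invertible a"
    and "aD = drazin_inverse a"
    and "f = a + b"
    and "s > 0"
    and "ring_invertible (1 + aD * b)"
    and "\<alpha> = ring_inverse (1 + aD * b)"
    and "\<beta> = ring_inverse (1 + b * aD)"
  defines "S1 \<equiv> (1 - a * aD) * b * a * aD = 0 \<and> (a + b) ^ s * (1 - a * aD) = 0"
    and "S2 \<equiv> a * aD * b * (1 - a * aD) = 0 \<and> (1 - a * aD) * (a + b) ^ s = 0"
    and "S3 \<equiv> a * aD * b = b * a * aD \<and> (1 - a * aD) * (a + b) ^ s = 0"
    and "S4 \<equiv> drazin_invertible f \<and> drazin_inverse f = \<alpha> * aD \<and> drazin_index f \<le> s"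
  shows "(S1 \<longleftrightarrow> S2) \<and> (S2 \<longleftrightarrow> S3) \<and> (S3 \<longleftrightarrow> S4) \<and>
    (S1 \<longrightarrow> T_l f = (\<lambda>x. \<alpha> * x) ` T_l a \<and> T_r f = (\<lambda>z. z * \<beta>) ` T_r a)"
proof -
  have drz: "is_drazin_inverse a aD"
    unfolding assms(3) by (rule is_drazin_inverse_drazin_inverse) fact
  then obtain k where "drazin_eqs a aD k" by (auto simp: is_drazin_inverse_def)
  note eqs = drazin_eqs_proj[OF this]
  define p where "p = a * aD"
  define u where "u = 1 + aD * b"
  define w where "w = 1 + b * aD"
  define y where "y = \<alpha> * aD"
  have pp: "p * p = p" and px: "p * aD = aD" and xp: "aD * p = aD" and pa: "p * a = a * p"
    and xa: "aD * a = p" and ax: "a * aD = p"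
    using eqs by (simp_all add: p_def)
  have u: "is_ring_inverse u \<alpha>"
    unfolding assms(7) u_def by (rule is_ring_inverse_ring_inverse) fact
  have w: "is_ring_inverse w \<beta>"
    unfolding assms(8) w_def
    by (rule is_ring_inverse_ring_inverse, rule ring_invertible_one_plus_swap) fact
  have \<alpha>: "u * \<alpha> = 1" "\<alpha> * u = 1" and \<beta>: "w * \<beta> = 1" "\<beta> * w = 1"
    using u w by (auto simp: is_ring_inverse_def)
  have y: "y = aD * \<beta>"
  proof -
    have "u * aD = aD * w" by (simp add: u_def w_def algebra_simps)
    then have "\<alpha> * (aD * w) * \<beta> = aD * \<beta>" by (metis \<alpha>(2) mult.assoc mult_1)
    then show ?thesis by (simp add: y_def \<beta> mult.assoc)
  qed
  have yp: "y * p = y" by (simp add: y_def mult.assoc xp)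
  have py: "p * y = y" by (simp add: y px flip: mult.assoc)
  have yf: "y * f = 1 - \<alpha> * (1 - p)"
  proof -
    have "aD * f = u - (1 - p)" by (simp add: u_def assms(4) algebra_simps xa)
    then have "y * f = \<alpha> * u - \<alpha> * (1 - p)" by (simp add: y_def mult.assoc right_diff_distrib)
    then show ?thesis by (simp add: \<alpha>)
  qed
  have fy: "f * y = 1 - (1 - p) * \<beta>"
  proof -
    have "f * aD = w - (1 - p)" by (simp add: w_def assms(4) algebra_simps ax)
    then have "f * y = w * \<beta> - (1 - p) * \<beta>" by (simp add: y left_diff_distrib flip: mult.assoc)
    then show ?thesis by (simp add: \<beta>)
  qed
  have yfp: "y * f * p = p" by (simp add: yf left_diff_distrib mult.assoc pp)
  have "p * (f * y) = p"
    by (simp add: fy right_diff_distrib pp flip: mult.assoc)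
  then have pfy: "p * f * y = p" by (simp add: mult.assoc)

  \<comment> \<open>Because \<open>p\<close> commutes with \<open>a\<close>, the off-diagonal blocks of \<open>b\<close> are those of \<open>f\<close>, and the first
    three conditions become statements about \<open>f\<close> and \<open>p\<close> alone.\<close>
  have S1: "S1 \<longleftrightarrow> f * p = p * f * p \<and> f ^ s * p = f ^ s"
  proof -
    have "(1 - p) * b * p = f * p - p * f * p"
      by (simp add: assms(4) algebra_simps) (metis pa pp mult.assoc)
    then show ?thesis
      unfolding S1_def assms(4)[symmetric] mult.assoc[of _ a aD] p_def[symmetric]
      by (auto simp: right_diff_distrib)
  qed
  have S2: "S2 \<longleftrightarrow> p * f = p * f * p \<and> p * f ^ s = f ^ s"
  proof -
    have "p * b * (1 - p) = p * f - p * f * p"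
      by (simp add: assms(4) algebra_simps) (metis pa pp mult.assoc)
    then show ?thesis
      unfolding S2_def assms(4)[symmetric] p_def[symmetric]
      by (auto simp: left_diff_distrib)
  qed
  have S3: "S3 \<longleftrightarrow> p * f = f * p \<and> p * f ^ s = f ^ s"
  proof -
    have "p * b = b * p \<longleftrightarrow> p * f = f * p"
      by (simp add: assms(4) distrib_left distrib_right pa)
    then show ?thesis
      unfolding S3_def assms(4)[symmetric] mult.assoc[of b a aD] p_def[symmetric]
      by (auto simp: left_diff_distrib)
  qed
  have pow_comm: "p * f ^ n = f ^ n * p" if "p * f = f * p" for n
    using that by (induction n) (simp, metis mult.assoc power_Suc)
  have "S1 \<longrightarrow> S3"
    using triangular_imp_commute[OF pp _ yfp] pow_comm unfolding S1 S3 by metis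
  moreover have "S2 \<longrightarrow> S3"
    using triangular_imp_commute'[OF pp _ pfy] unfolding S2 S3 by metis
  moreover have "S3 \<longrightarrow> S1 \<and> S2"
    unfolding S1 S2 S3 using pow_comm by (metis mult.assoc pp)
  moreover have f_drz: "drazin_eqs f y s" if "S3"
  proof -
    have pf: "p * f = f * p" and s: "p * f ^ s = f ^ s" using that S3 by auto
    have 1: "y * f = p" by (metis yp yfp pf mult.assoc)
    have 2: "f * y = p" by (metis py pfy pf mult.assoc)
    show ?thesis
      unfolding drazin_eqs_def using s by (simp add: 1 2 py power2_eq_square flip: mult.assoc)
  qed
  moreover have "S4" if "S3"
    using f_drz[OF that] drazin_index_le[OF f_drz[OF that]] drazin_inverse_eqI[of f y] assms(5)
    unfolding S4_def y_def drazin_invertible_def is_drazin_inverse_def by blast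
  moreover have "S2" if "S4"
  proof -
    have f: "is_drazin_inverse f y"
      using that is_drazin_inverse_drazin_inverse[of f] by (simp add: S4_def y_def)
    have eq: "drazin_eqs f y (drazin_index f)" by (rule drazin_eqs_drazin_index[OF f])
    have "y * f = f * y" using eq by (simp add: drazin_eqs_def)
    \<comment> \<open>\<open>y f = f y = f y p = y f p = p\<close>\<close>
    then have p: "f * y = p" "y * f = p" by (metis yp yfp mult.assoc)+
    then have "p * f = p * f * p" by (metis mult.assoc pp)
    moreover have "p * f ^ s = f ^ s"
      using drazin_eqs_proj_power(1)[OF eq, of s] that by (simp add: S4_def p)
    ultimately show ?thesis by (simp add: S2)
  qed
  moreover have "T_l f = (\<lambda>x. \<alpha> * x) ` T_l a \<and> T_r f = (\<lambda>z. z * \<beta>) ` T_r a" if "S3"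
  proof -
    have pf: "p * f = f * p" using that S3 by auto
    have f: "is_drazin_inverse f y"
      using f_drz[OF that] assms(5) by (auto simp: is_drazin_inverse_def)
    have fy: "f * y = p" by (metis py pfy pf mult.assoc)
    have pb: "p * b = b * p"
      using pf by (simp add: assms(4) distrib_left distrib_right pa)
    have "p * u = u * p"
      by (simp add: u_def distrib_left distrib_right) (metis pb px xp mult.assoc)
    note u_comm = this is_ring_inverse_commute[OF u this]
    have "p * w = w * p"
      by (simp add: w_def distrib_left distrib_right) (metis pb px xp mult.assoc)
    note w_comm = this is_ring_inverse_commute[OF w this]
    have Tl: "T_l c = {z. p * z = z \<and> z * p = d}" if "is_drazin_inverse c d" "c * d = p" for c d
      using T_l_eq[OF that(1)] by (simp add: that(2))
    have Tr: "T_r c = {z. z * p = z \<and> p * z = d}" if "is_drazin_inverse c d" "c * d = p" for c d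
      using T_r_eq[OF that(1)] by (simp add: that(2))
    have "T_l f = (\<lambda>x. \<alpha> * x) ` T_l a"
    proof (intro equalityI subsetI)
      fix z assume "z \<in> T_l f"
      then have z: "p * z = z" "z * p = y" by (auto simp: Tl[OF f fy])
      have "u * z \<in> T_l a"
        unfolding Tl[OF drz ax]
        by (simp add: mult.assoc z) (metis z(1) u_comm(1) y_def \<alpha>(1) mult.assoc mult_1)
      moreover have "z = \<alpha> * (u * z)" by (simp add: \<alpha> flip: mult.assoc)
      ultimately show "z \<in> (\<lambda>x. \<alpha> * x) ` T_l a" by blast
    next
      fix z assume "z \<in> (\<lambda>x. \<alpha> * x) ` T_l a"
      then obtain x where z: "z = \<alpha> * x" and x: "p * x = x" "x * p = aD"
        by (auto simp: Tl[OF drz ax])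
      show "z \<in> T_l f"
        unfolding Tl[OF f fy] z by (simp add: mult.assoc x y_def) (metis x(1) u_comm(2) mult.assoc)
    qed
    moreover have "T_r f = (\<lambda>z. z * \<beta>) ` T_r a"
    proof (intro equalityI subsetI)
      fix z assume "z \<in> T_r f"
      then have z: "z * p = z" "p * z = y" by (auto simp: Tr[OF f fy])
      have "z * w \<in> T_r a"
        unfolding Tr[OF drz ax]
        by (simp add: z flip: mult.assoc)
          (metis z(1) w_comm(1) y \<beta>(2) mult.assoc mult_1_right)
      moreover have "z = (z * w) * \<beta>" by (simp add: \<beta> mult.assoc)
      ultimately show "z \<in> (\<lambda>z. z * \<beta>) ` T_r a" by blast
    next
      fix z assume "z \<in> (\<lambda>z. z * \<beta>) ` T_r a"
      then obtain x where z: "z = x * \<beta>" and x: "x * p = x" "p * x = aD"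
        by (auto simp: Tr[OF drz ax])
      show "z \<in> T_r f"
        unfolding Tr[OF f fy] z
        by (simp add: x y flip: mult.assoc) (metis x(1) w_comm(2) mult.assoc)
    qed
    ultimately show ?thesis ..
  qed
  ultimately show ?thesis by blast
qed

end
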